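(* Let $F\dashv G:\mathcal{C}\to\mathcal{A}$ be adjoint functors (so $F:\mathcal{A}\to\mathcal{C}$ is left adjoint to $G$) with unit $\eta:1_{\mathcal{A}}\to GF$, and assume that $G$ and $F$ preserve subobjects. Let $\mathcal{S}$ be a simple co-perfect syntopogenous structure on $\mathcal{C}$ with respect to $\mathcal{M}$, i.e. $\mathcal{S}_Y=\{\sqsubset_Y\}$ for every $Y\in\mathcal{C}$, where $\sqsubset$ is a $\bigwedge$-preserving interpolative topogenous order on $\mathcal{C}$. Then $$c^{\sqsubset^{\eta}}_X(m)=\eta_X^{-1}\big(G(c^{\sqsubset}_{FX}(Fm))\big)\qquad(m\in\mathrm{sub}X,\ X\in\mathcal{A})$$ defines an idempotent closure operator on $\mathcal{A}$. It is the largest closure operator on $\mathcal{A}$ for which $F$ is $(c^{\sqsubset^{\eta}},c^{\sqsubset})$-continuous.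
   Context: $\mathcal{C}$ is a category with a proper $(\mathcal{E},\mathcal{M})$-factorization system for morphisms ($\mathcal{E}$ consists of epimorphisms, $\mathcal{M}$ of monomorphisms), and it is $\mathcal{M}$-complete: pullbacks of $\mathcal{M}$-morphisms along arbitrary morphisms and arbitrary $\mathcal{M}$-intersections exist and are again in $\mathcal{M}$. Likewise $\mathcal{A}$ is a category with an $(\mathcal{E}',\mathcal{M}')$-factorization system and is $\mathcal{M}'$-complete. For $X\in\mathcal{C}$, $\mathrm{sub}X=\{m\in\mathcal{M}\mid \mathrm{cod}(m)=X\}$, ordered by $n\le m$ iff $m\circ j=n$ for some $j$; isomorphic subobjects are identified, so $\mathrm{sub}X$ is a (possibly large) complete lattice. For $f:X\to Y$, $f(m)$ is the $\mathcal{M}$-component of the factorization of $f\circ m$ and $f^{-1}(n)$ is the pullback of $n$ along $f$. The same conventions apply to $\mathcal{A}$ with $\mathcal{M}'$. $F$ preserves subobjects if $Fm\in\mathcal{M}$ for every $m\in\mathcal{M}'$; $G$ preserves subobjects if $Gn\in\mathcal{M}'$ for every $n\in\mathcal{M}$. A topogenous order on $\mathcal{C}$ is a family of relations $\sqsubset_X$ on $\mathrm{sub}X$ with (T1) $m\sqsubset_X n\Rightarrow m\le n$; (T2) $m\le n\sqsubset_X p\le q\Rightarrow m\sqsubset_X q$; (T3) for every $f:X\to Y$, $m\sqsubset_Y n\Rightarrow f^{-1}(m)\sqsubset_X f^{-1}(n)$. It is $\bigwedge$-preserving if ($m\sqsubset_X n_i$ for all $i\in I$) implies $m\sqsubset_X\bigwedge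 n_i$, and interpolative if $m\sqsubset_X n$ implies $m\sqsubset_X p\sqsubset_X n$ for some $p$. For such $\sqsubset$, $c^{\sqsubset}_X(m)=\bigwedge\{p\mid m\sqsubset_X p\}$. A closure operator $c$ (on $\mathcal{C}$ with respect to $\mathcal{M}$, or on $\mathcal{A}$ with respect to $\mathcal{M}'$) is a family of maps $c_X:\mathrm{sub}X\to\mathrm{sub}X$ with (C1) $m\le c_X(m)$; (C2) $m\le n\Rightarrow c_X(m)\le c_X(n)$; (C3) $f(c_X(m))\le c_Y(f(m))$ for every $f:X\to Y$ and $m\in\mathrm{sub}X$. It is idempotent if $c_X(c_X(m))=c_X(m)$. Order: $c\le c'$ iff $c_X(m)\le c'_X(m)$ for all $X$ and $m$. For closure operators $c'$ on $\mathcal{A}$ and $c$ on $\mathcal{C}$, $F$ is $(c',c)$-continuous if $F(c'_X(m))\le c_{FX}(Fm)$ for all $X\in\mathcal{A}$, $m\in\mathrm{sub}X$. *)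

theory Defs
  imports Main
begin

section \<open>Categories, functors and adjunctions\<close>

text \<open>
  The class of objects and the class of arrows are carrier sets, which may be arbitrarily large;
  composition is written in the order of function composition and is meaningful only on
  composable pairs of arrows.
\<close>

record ('o, 'a) cat =
  Obj :: "'o set"
  Arr :: "'a set"
  Dom :: "'a \<Rightarrow> 'o"
  Cod :: "'a \<Rightarrow> 'o"
  Ident :: "'o \<Rightarrow> 'a"
  Comp :: "'a \<Rightarrow> 'a \<Rightarrow> 'a"  (infixr "\<cdot>\<index>" 70)

definition Hom :: "('o, 'a) cat \<Rightarrow> 'o \<Rightarrow> 'o \<Rightarrow> 'a set"
  where "Hom C X Y = {f \<in> Arr C. Dom C f = X \<and> Cod C f = Y}"

locale category =
  fixes C :: "('o, 'a) cat" (structure)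
  assumes Dom_Obj: "f \<in> Arr C \<Longrightarrow> Dom C f \<in> Obj C"
    and Cod_Obj: "f \<in> Arr C \<Longrightarrow> Cod C f \<in> Obj C"
    and Ident_Hom: "X \<in> Obj C \<Longrightarrow> Ident C X \<in> Hom C X X"
    and Comp_Hom: "f \<in> Hom C X Y \<Longrightarrow> g \<in> Hom C Y Z \<Longrightarrow> g \<cdot> f \<in> Hom C X Z"
    and Comp_Ident: "f \<in> Hom C X Y \<Longrightarrow> f \<cdot> Ident C X = f"
    and Ident_Comp: "f \<in> Hom C X Y \<Longrightarrow> Ident C Y \<cdot> f = f"
    and Comp_assoc: "f \<in> Hom C W X \<Longrightarrow> g \<in> Hom C X Y \<Longrightarrow> h \<in> Hom C Y Z \<Longrightarrow>
      (h \<cdot> g) \<cdot> f = h \<cdot> (g \<cdot> f)"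

definition mono_arrs :: "('o, 'a) cat \<Rightarrow> 'a set"
  where "mono_arrs C = {m \<in> Arr C. \<forall>W. \<forall>g \<in> Hom C W (Dom C m). \<forall>h \<in> Hom C W (Dom C m).
    m \<cdot>\<^bsub>C\<^esub> g = m \<cdot>\<^bsub>C\<^esub> h \<longrightarrow> g = h}"

definition epi_arrs :: "('o, 'a) cat \<Rightarrow> 'a set"
  where "epi_arrs C = {e \<in> Arr C. \<forall>Z. \<forall>g \<in> Hom C (Cod C e) Z. \<forall>h \<in> Hom C (Cod C e) Z.
    g \<cdot>\<^bsub>C\<^esub> e = h \<cdot>\<^bsub>C\<^esub> e \<longrightarrow> g = h}"

definition iso_arrs :: "('o, 'a) cat \<Rightarrow> 'a set"
  where "iso_arrs C = {f \<in> Arr C. \<exists>g \<in> Hom C (Cod C f) (Dom C f).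
    g \<cdot>\<^bsub>C\<^esub> f = Ident C (Dom C f) \<and> f \<cdot>\<^bsub>C\<^esub> g = Ident C (Cod C f)}"

definition is_pullback :: "('o, 'a) cat \<Rightarrow> 'a \<Rightarrow> 'a \<Rightarrow> 'a \<Rightarrow> 'a \<Rightarrow> bool"
  where "is_pullback C f n p q \<longleftrightarrow>
    f \<in> Arr C \<and> n \<in> Arr C \<and> p \<in> Arr C \<and> q \<in> Arr C \<and>
    Cod C f = Cod C n \<and> Dom C p = Dom C q \<and> Cod C p = Dom C f \<and> Cod C q = Dom C n \<and>
    f \<cdot>\<^bsub>C\<^esub> p = n \<cdot>\<^bsub>C\<^esub> q \<and>
    (\<forall>W. \<forall>u \<in> Hom C W (Dom C f). \<forall>v \<in> Hom C W (Dom C n). f \<cdot>\<^bsub>C\<^esub> u = n \<cdot>\<^bsub>C\<^esub> v \<longrightarrow>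
      (\<exists>!d. d \<in> Hom C W (Dom C p) \<and> p \<cdot>\<^bsub>C\<^esub> d = u \<and> q \<cdot>\<^bsub>C\<^esub> d = v))"

record ('p, 'b, 'o, 'a) fctr =
  omap :: "'p \<Rightarrow> 'o"
  amap :: "'b \<Rightarrow> 'a"

locale cat_functor = A: category A + C: category C
  for A :: "('p, 'b) cat" and C :: "('o, 'a) cat" and F :: "('p, 'b, 'o, 'a) fctr" +
  assumes omap_Obj: "X \<in> Obj A \<Longrightarrow> omap F X \<in> Obj C"
    and amap_Hom: "f \<in> Hom A X Y \<Longrightarrow> amap F f \<in> Hom C (omap F X) (omap F Y)"
    and amap_Ident: "X \<in> Obj A \<Longrightarrow> amap F (Ident A X) = Ident C (omap F X)"
    and amap_Comp: "f \<in> Hom A X Y \<Longrightarrow> g \<in> Hom A Y Z \<Longrightarrow>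
      amap F (g \<cdot>\<^bsub>A\<^esub> f) = amap F g \<cdot>\<^bsub>C\<^esub> amap F f"

text \<open>\<open>F\<close> is left adjoint to \<open>G\<close> with unit \<open>\<eta>\<close>: each \<open>\<eta> X\<close> is a universal arrow from \<open>X\<close> to \<open>G\<close>.\<close>

locale adjunction_with_unit = F: cat_functor A C F + G: cat_functor C A G
  for A :: "('p, 'b) cat" and C :: "('o, 'a) cat"
    and F :: "('p, 'b, 'o, 'a) fctr" and G :: "('o, 'a, 'p, 'b) fctr" and \<eta> :: "'p \<Rightarrow> 'b" +
  assumes unit_Hom: "X \<in> Obj A \<Longrightarrow> \<eta> X \<in> Hom A X (omap G (omap F X))"
    and unit_natural: "f \<in> Hom A X X' \<Longrightarrow> amap G (amap F f) \<cdot>\<^bsub>A\<^esub> \<eta> X = \<eta> X' \<cdot>\<^bsub>A\<^esub> f"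
    and unit_universal: "X \<in> Obj A \<Longrightarrow> Y \<in> Obj C \<Longrightarrow> f \<in> Hom A X (omap G Y) \<Longrightarrow>
      \<exists>!g. g \<in> Hom C (omap F X) Y \<and> amap G g \<cdot>\<^bsub>A\<^esub> \<eta> X = f"


section \<open>Factorization systems and completeness\<close>

locale factorization_system = category C
  for C :: "('o, 'a) cat" (structure) +
  fixes E M :: "'a set"
  assumes E_Arr: "E \<subseteq> Arr C"
    and M_Arr: "M \<subseteq> Arr C"
    and E_iso: "e \<in> E \<Longrightarrow> h \<in> iso_arrs C \<Longrightarrow> Dom C h = Cod C e \<Longrightarrow> h \<cdot> e \<in> E"
    and M_iso: "m \<in> M \<Longrightarrow> h \<in> iso_arrs C \<Longrightarrow> Cod C h = Dom C m \<Longrightarrow> m \<cdot> h \<in> M"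
    and factorization: "f \<in> Arr C \<Longrightarrow> \<exists>e \<in> E. \<exists>m \<in> M. Cod C e = Dom C m \<and> f = m \<cdot> e"
    and diagonalization: "e \<in> E \<Longrightarrow> m \<in> M \<Longrightarrow>
      u \<in> Hom C (Dom C e) (Dom C m) \<Longrightarrow> v \<in> Hom C (Cod C e) (Cod C m) \<Longrightarrow> v \<cdot> e = m \<cdot> u \<Longrightarrow>
      \<exists>!d. d \<in> Hom C (Cod C e) (Dom C m) \<and> d \<cdot> e = u \<and> m \<cdot> d = v"

definition factors_through :: "('o, 'a) cat \<Rightarrow> 'a \<Rightarrow> 'a \<Rightarrow> bool"
  where "factors_through C f m \<longleftrightarrow> Cod C f = Cod C m \<and>
    (\<exists>j \<in> Hom C (Dom C f) (Dom C m). m \<cdot>\<^bsub>C\<^esub> j = f)"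

text \<open>
  The mediating factorization in an intersection is unique as soon as \<open>m\<close> is a monomorphism.
  The empty intersection, too, is relative to the ambient object \<open>X\<close>.
\<close>

definition is_intersection :: "('o, 'a) cat \<Rightarrow> 'o \<Rightarrow> 'a set \<Rightarrow> 'a \<Rightarrow> bool"
  where "is_intersection C X S m \<longleftrightarrow> m \<in> Arr C \<and> Cod C m = X \<and>
    (\<forall>n \<in> S. factors_through C m n) \<and>
    (\<forall>f \<in> Arr C. Cod C f = X \<and> (\<forall>n \<in> S. factors_through C f n) \<longrightarrow> factors_through C f m)"

locale complete_factorization_system = factorization_system C E M
  for C :: "('o, 'a) cat" (structure) and E M :: "'a set" +
  assumes M_pullback: "f \<in> Arr C \<Longrightarrow> n \<in> M \<Longrightarrow> Cod C f = Cod C n \<Longrightarrow>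
      \<exists>p \<in> M. \<exists>q. is_pullback C f n p q"
    and M_intersection: "X \<in> Obj C \<Longrightarrow> S \<subseteq> {n \<in> M. Cod C n = X} \<Longrightarrow>
      \<exists>m \<in> M. is_intersection C X S m"

locale proper_complete_factorization_system = complete_factorization_system C E M
  for C :: "('o, 'a) cat" (structure) and E M :: "'a set" +
  assumes E_epis: "E \<subseteq> epi_arrs C"
    and M_monos: "M \<subseteq> mono_arrs C"


section \<open>The lattices of subobjects\<close>

text \<open>
  A subobject of \<open>X\<close> is an equivalence class of arrows in \<open>M\<close> with codomain \<open>X\<close>, two of them being
  identified if each factors through the other. For monomorphisms this means that they are
  isomorphic over \<open>X\<close>; see \<open>sub_equiv_iff_iso\<close> below.
\<close>

definition sub_equiv :: "('o, 'a) cat \<Rightarrow> 'a \<Rightarrow> 'a \<Rightarrow> bool"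
  where "sub_equiv C n m \<longleftrightarrow> factors_through C n m \<and> factors_through C m n"

definition sub_class :: "('o, 'a) cat \<Rightarrow> 'a set \<Rightarrow> 'a \<Rightarrow> 'a set"
  where "sub_class C M m = {n \<in> M. sub_equiv C n m}"

definition sub :: "('o, 'a) cat \<Rightarrow> 'a set \<Rightarrow> 'o \<Rightarrow> 'a set set"
  where "sub C M X = sub_class C M ` {m \<in> M. Cod C m = X}"

definition sub_le :: "('o, 'a) cat \<Rightarrow> 'a set \<Rightarrow> 'a set \<Rightarrow> bool"
  where "sub_le C K N \<longleftrightarrow> (\<exists>k \<in> K. \<exists>n \<in> N. factors_through C k n)"

definition sub_Inf :: "('o, 'a) cat \<Rightarrow> 'a set \<Rightarrow> 'o \<Rightarrow> 'a set set \<Rightarrow> 'a set"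
  where "sub_Inf C M X S = (THE K. K \<in> sub C M X \<and> (\<forall>N \<in> S. sub_le C K N) \<and>
    (\<forall>L \<in> sub C M X. (\<forall>N \<in> S. sub_le C L N) \<longrightarrow> sub_le C L K))"

text \<open>
  The following operations take the union over all representatives and over all choices of
  pullbacks and factorizations; all of these choices yield one and the same class.
\<close>

definition sub_preimage :: "('o, 'a) cat \<Rightarrow> 'a set \<Rightarrow> 'a \<Rightarrow> 'a set \<Rightarrow> 'a set"
  where "sub_preimage C M f N = (\<Union>n \<in> N. \<Union>p \<in> {p. \<exists>q. is_pullback C f n p q}. sub_class C M p)"

definition sub_image :: "('o, 'a) cat \<Rightarrow> 'a set \<Rightarrow> 'a set \<Rightarrow> 'a \<Rightarrow> 'a set \<Rightarrow> 'a set"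
  where "sub_image C E M f K = (\<Union>k \<in> K.
    \<Union>m \<in> {m \<in> M. \<exists>e \<in> E. Cod C e = Dom C m \<and> f \<cdot>\<^bsub>C\<^esub> k = m \<cdot>\<^bsub>C\<^esub> e}. sub_class C M m)"

definition preserves_subobjects :: "('p, 'b, 'o, 'a) fctr \<Rightarrow> 'b set \<Rightarrow> 'a set \<Rightarrow> bool"
  where "preserves_subobjects F M' M \<longleftrightarrow> (\<forall>m \<in> M'. amap F m \<in> M)"

text \<open>Here \<open>C\<close> and \<open>M\<close> belong to the target of \<open>F\<close>.\<close>

definition fctr_sub :: "('o, 'a) cat \<Rightarrow> 'a set \<Rightarrow> ('p, 'b, 'o, 'a) fctr \<Rightarrow> 'b set \<Rightarrow> 'a set"
  where "fctr_sub C M F K = (\<Union>k \<in> K. sub_class C M (amap F k))"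

lemma (in category) sub_equiv_iff_iso:
  assumes "m \<in> mono_arrs C" and "n \<in> mono_arrs C"
  shows "sub_equiv C n m \<longleftrightarrow>
    Cod C n = Cod C m \<and> (\<exists>j \<in> iso_arrs C. Dom C j = Dom C n \<and> Cod C j = Dom C m \<and> m \<cdot> j = n)"
proof
  assume "sub_equiv C n m"
  then obtain j k where cod: "Cod C n = Cod C m"
    and j: "j \<in> Hom C (Dom C n) (Dom C m)" "m \<cdot> j = n"
    and k: "k \<in> Hom C (Dom C m) (Dom C n)" "n \<cdot> k = m"
    unfolding sub_equiv_def factors_through_def by blast
  have m: "m \<in> Hom C (Dom C m) (Cod C m)" and n: "n \<in> Hom C (Dom C n) (Cod C n)"
    using assms by (auto simp: mono_arrs_def Hom_def)
  have objs: "Dom C m \<in> Obj C" "Dom C n \<in> Obj C"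
    using m n Dom_Obj by (auto simp: Hom_def)
  have "m \<cdot> (j \<cdot> k) = m \<cdot> Ident C (Dom C m)"
    using Comp_assoc[OF k(1) j(1) m] j(2) k(2) Comp_Ident[OF m] by simp
  then have jk: "j \<cdot> k = Ident C (Dom C m)"
    using assms(1) Comp_Hom[OF k(1) j(1)] Ident_Hom[OF objs(1)] unfolding mono_arrs_def by blast
  have "n \<cdot> (k \<cdot> j) = n \<cdot> Ident C (Dom C n)"
    using Comp_assoc[OF j(1) k(1) n] j(2) k(2) Comp_Ident[OF n] by simp
  then have kj: "k \<cdot> j = Ident C (Dom C n)"
    using assms(2) Comp_Hom[OF j(1) k(1)] Ident_Hom[OF objs(2)] unfolding mono_arrs_def by blast
  have "j \<in> iso_arrs C"
    using j(1) k(1) jk kj by (auto simp: iso_arrs_def Hom_def)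
  then show "Cod C n = Cod C m \<and>
      (\<exists>j \<in> iso_arrs C. Dom C j = Dom C n \<and> Cod C j = Dom C m \<and> m \<cdot> j = n)"
    using cod j by (auto simp: Hom_def)
next
  assume "Cod C n = Cod C m \<and>
    (\<exists>j \<in> iso_arrs C. Dom C j = Dom C n \<and> Cod C j = Dom C m \<and> m \<cdot> j = n)"
  then obtain j k where cod: "Cod C n = Cod C m"
    and j: "j \<in> Hom C (Dom C n) (Dom C m)" "m \<cdot> j = n"
    and k: "k \<in> Hom C (Dom C m) (Dom C n)" "j \<cdot> k = Ident C (Dom C m)"
    unfolding iso_arrs_def Hom_def by auto
  have m: "m \<in> Hom C (Dom C m) (Cod C m)"
    using assms by (auto simp: mono_arrs_def Hom_def)
  have "n \<cdot> k = m"
    using Comp_assoc[OF k(1) j(1) m] j(2) k(2) Comp_Ident[OF m] by simp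
  then show "sub_equiv C n m"
    using cod j k(1) unfolding sub_equiv_def factors_through_def by auto
qed


section \<open>Topogenous orders and closure operators\<close>

locale topogenous_order =
  fixes C :: "('o, 'a) cat" and M :: "'a set" and R :: "'o \<Rightarrow> 'a set \<Rightarrow> 'a set \<Rightarrow> bool"
  assumes on_sub: "X \<in> Obj C \<Longrightarrow> R X m n \<Longrightarrow> m \<in> sub C M X \<and> n \<in> sub C M X"
    and T1: "X \<in> Obj C \<Longrightarrow> R X m n \<Longrightarrow> sub_le C m n"
    and T2: "X \<in> Obj C \<Longrightarrow> m \<in> sub C M X \<Longrightarrow> q \<in> sub C M X \<Longrightarrow>
      sub_le C m n \<Longrightarrow> R X n p \<Longrightarrow> sub_le C p q \<Longrightarrow> R X m q"
    and T3: "f \<in> Hom C X Y \<Longrightarrow> R Y m n \<Longrightarrow> R X (sub_preimage C M f m) (sub_preimage C M f n)"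

definition Inf_preserving ::
  "('o, 'a) cat \<Rightarrow> 'a set \<Rightarrow> ('o \<Rightarrow> 'a set \<Rightarrow> 'a set \<Rightarrow> bool) \<Rightarrow> bool"
  where "Inf_preserving C M R \<longleftrightarrow> (\<forall>X \<in> Obj C. \<forall>m \<in> sub C M X. \<forall>S \<subseteq> sub C M X.
    (\<forall>n \<in> S. R X m n) \<longrightarrow> R X m (sub_Inf C M X S))"

definition interpolative ::
  "('o, 'a) cat \<Rightarrow> 'a set \<Rightarrow> ('o \<Rightarrow> 'a set \<Rightarrow> 'a set \<Rightarrow> bool) \<Rightarrow> bool"
  where "interpolative C M R \<longleftrightarrow> (\<forall>X \<in> Obj C. \<forall>m \<in> sub C M X. \<forall>n \<in> sub C M X.
    R X m n \<longrightarrow> (\<exists>p \<in> sub C M X. R X m p \<and> R X p n))"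

definition topogenous_closure ::
  "('o, 'a) cat \<Rightarrow> 'a set \<Rightarrow> ('o \<Rightarrow> 'a set \<Rightarrow> 'a set \<Rightarrow> bool) \<Rightarrow> 'o \<Rightarrow> 'a set \<Rightarrow> 'a set"
  where "topogenous_closure C M R X m = sub_Inf C M X {p \<in> sub C M X. R X m p}"

locale closure_operator =
  fixes C :: "('o, 'a) cat" and E M :: "'a set" and c :: "'o \<Rightarrow> 'a set \<Rightarrow> 'a set"
  assumes closed_sub: "X \<in> Obj C \<Longrightarrow> m \<in> sub C M X \<Longrightarrow> c X m \<in> sub C M X"
    and C1: "X \<in> Obj C \<Longrightarrow> m \<in> sub C M X \<Longrightarrow> sub_le C m (c X m)"
    and C2: "X \<in> Obj C \<Longrightarrow> m \<in> sub C M X \<Longrightarrow> n \<in> sub C M X \<Longrightarrow> sub_le C m n \<Longrightarrow>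
      sub_le C (c X m) (c X n)"
    and C3: "f \<in> Hom C X Y \<Longrightarrow> m \<in> sub C M X \<Longrightarrow>
      sub_le C (sub_image C E M f (c X m)) (c Y (sub_image C E M f m))"

definition idempotent_on_sub ::
  "('o, 'a) cat \<Rightarrow> 'a set \<Rightarrow> ('o \<Rightarrow> 'a set \<Rightarrow> 'a set) \<Rightarrow> bool"
  where "idempotent_on_sub C M c \<longleftrightarrow> (\<forall>X \<in> Obj C. \<forall>m \<in> sub C M X. c X (c X m) = c X m)"

definition closure_le ::
  "('o, 'a) cat \<Rightarrow> 'a set \<Rightarrow> ('o \<Rightarrow> 'a set \<Rightarrow> 'a set) \<Rightarrow> ('o \<Rightarrow> 'a set \<Rightarrow> 'a set) \<Rightarrow> bool"
  where "closure_le C M c c' \<longleftrightarrow> (\<forall>X \<in> Obj C. \<forall>m \<in> sub C M X. sub_le C (c X m) (c' X m))"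

definition continuous_fctr ::
  "('p, 'b) cat \<Rightarrow> 'b set \<Rightarrow> ('o, 'a) cat \<Rightarrow> 'a set \<Rightarrow> ('p, 'b, 'o, 'a) fctr \<Rightarrow>
    ('p \<Rightarrow> 'b set \<Rightarrow> 'b set) \<Rightarrow> ('o \<Rightarrow> 'a set \<Rightarrow> 'a set) \<Rightarrow> bool"
  where "continuous_fctr A M' C M F c' c \<longleftrightarrow> (\<forall>X \<in> Obj A. \<forall>m \<in> sub A M' X.
    sub_le C (fctr_sub C M F (c' X m)) (c (omap F X) (fctr_sub C M F m)))"

definition unit_closure ::
  "('p, 'b) cat \<Rightarrow> 'b set \<Rightarrow> ('o, 'a) cat \<Rightarrow> 'a set \<Rightarrow>
    ('p, 'b, 'o, 'a) fctr \<Rightarrow> ('o, 'a, 'p, 'b) fctr \<Rightarrow> ('p \<Rightarrow> 'b) \<Rightarrow>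
    ('o \<Rightarrow> 'a set \<Rightarrow> 'a set \<Rightarrow> bool) \<Rightarrow> 'p \<Rightarrow> 'b set \<Rightarrow> 'b set"
  where "unit_closure A M' C M F G \<eta> R X m =
    sub_preimage A M' (\<eta> X)
      (fctr_sub A M' G (topogenous_closure C M R (omap F X) (fctr_sub C M F m)))"

end

theory Submission
  imports Defs
begin

text \<open>
  The subobject \<open>\<eta>\<^sub>X\<^sup>-\<^sup>1(G n)\<close> is characterized by a universal property: transposing across the
  adjunction, an arrow \<open>g\<close> into \<open>X\<close> factors through it iff \<open>F g\<close> factors through \<open>n\<close>. For
  \<open>n = c(F m)\<close> this says that \<open>k \<le> \<eta>\<^sub>X\<^sup>-\<^sup>1(G(c(F m)))\<close> iff \<open>F k \<le> c(F m)\<close>. Continuity of \<open>F\<close>,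
  maximality, (C1), (C2) and idempotence are read off from this equivalence and the corresponding
  properties of \<open>c\<close>; (C3) moreover uses \<open>c(f\<^sup>-\<^sup>1(n)) \<le> f\<^sup>-\<^sup>1(c(n))\<close>, which is (T3).
\<close>

section \<open>Factoring through an arrow\<close>

context category
begin

lemma Arr_Hom: "f \<in> Arr C \<Longrightarrow> f \<in> Hom C (Dom C f) (Cod C f)"
  by (simp add: Hom_def)

lemma factors_throughE:
  assumes "factors_through C f m"
  obtains j where "Cod C f = Cod C m" "j \<in> Hom C (Dom C f) (Dom C m)" "m \<cdot> j = f"
  using assms unfolding factors_through_def by blast

lemma factors_through_refl: "f \<in> Arr C \<Longrightarrow> factors_through C f f"
  unfolding factors_through_def
  using Comp_Ident[OF Arr_Hom] Ident_Hom[OF Dom_Obj] by blast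

lemma factors_through_Comp:
  assumes "m \<in> Arr C" "j \<in> Hom C W (Dom C m)"
  shows "factors_through C (m \<cdot> j) m"
  using Comp_Hom[OF assms(2) Arr_Hom[OF assms(1)]] assms(2)
  unfolding factors_through_def Hom_def by auto

lemma factors_through_trans:
  assumes "factors_through C f g" "factors_through C g h" "h \<in> Arr C"
  shows "factors_through C f h"
proof -
  obtain i where i: "Cod C f = Cod C g" "i \<in> Hom C (Dom C f) (Dom C g)" "g \<cdot> i = f"
    using assms(1) by (rule factors_throughE)
  obtain j where j: "Cod C g = Cod C h" "j \<in> Hom C (Dom C g) (Dom C h)" "h \<cdot> j = g"
    using assms(2) by (rule factors_throughE)
  have "h \<cdot> (j \<cdot> i) = f"
    using Comp_assoc[OF i(2) j(2) Arr_Hom[OF assms(3)]] i(3) j(3) by simp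
  then show ?thesis
    using i(1) j(1) Comp_Hom[OF i(2) j(2)] unfolding factors_through_def by auto
qed

lemma factors_through_Comp_left:
  assumes "factors_through C f m" "m \<in> Arr C" "h \<in> Hom C (Cod C m) Z"
  shows "factors_through C (h \<cdot> f) (h \<cdot> m)"
proof -
  obtain j where j: "j \<in> Hom C (Dom C f) (Dom C m)" "m \<cdot> j = f"
    using assms(1) by (rule factors_throughE)
  have hm: "h \<cdot> m \<in> Hom C (Dom C m) Z"
    using Comp_Hom[OF Arr_Hom[OF assms(2)] assms(3)] .
  have "(h \<cdot> m) \<cdot> j = h \<cdot> f"
    using Comp_assoc[OF j(1) Arr_Hom[OF assms(2)] assms(3)] j(2) by simp
  then show ?thesis
    using factors_through_Comp[of "h \<cdot> m" j] hm j(1) by (auto simp: Hom_def)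
qed

text \<open>The universal property of the pullback in the form used throughout: which arrows factor
  through \<open>p\<close> depends only on \<open>f\<close> and \<open>n\<close>. Commutativity of
  the square gives one direction, the mediating arrow the other.\<close>

lemma pullback_factors_through_iff:
  assumes "is_pullback C f n p q" "g \<in> Arr C" "Cod C g = Dom C f"
  shows "factors_through C g p \<longleftrightarrow> factors_through C (f \<cdot> g) n"
proof
  have pb: "f \<in> Arr C" "n \<in> Arr C" "p \<in> Arr C" "q \<in> Arr C" "Cod C f = Cod C n"
    "Dom C p = Dom C q" "Cod C p = Dom C f" "Cod C q = Dom C n" "f \<cdot> p = n \<cdot> q"
    using assms(1) unfolding is_pullback_def by auto
  have fg: "f \<cdot> g \<in> Hom C (Dom C g) (Cod C f)"
    using Comp_Hom[of g _ _ f] assms(2,3) pb(1) by (auto simp: Hom_def)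
  {
    assume "factors_through C g p"
    then have "factors_through C (f \<cdot> g) (n \<cdot> q)"
      using factors_through_Comp_left[of g p f] pb by (auto simp: Hom_def)
    moreover have "factors_through C (n \<cdot> q) n"
      using factors_through_Comp[of n q] pb by (auto simp: Hom_def)
    ultimately show "factors_through C (f \<cdot> g) n"
      using factors_through_trans pb(2) by blast
  next
    assume "factors_through C (f \<cdot> g) n"
    then obtain v where v: "v \<in> Hom C (Dom C g) (Dom C n)" "f \<cdot> g = n \<cdot> v"
      using fg by (auto simp: Hom_def elim: factors_throughE)
    have "g \<in> Hom C (Dom C g) (Dom C f)"
      using assms(2,3) by (simp add: Hom_def)
    then have "\<exists>!d. d \<in> Hom C (Dom C g) (Dom C p) \<and> p \<cdot> d = g \<and> q \<cdot> d = v"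
      using assms(1) v unfolding is_pullback_def by blast
    then show "factors_through C g p"
      using pb(7) assms(3) unfolding factors_through_def by auto
  }
qed

end


section \<open>Subobjects, their preimages, images and intersections\<close>

context factorization_system
begin

lemma M_in_Arr: "m \<in> M \<Longrightarrow> m \<in> Arr C"
  using M_Arr by blast

lemma sub_equiv_refl: "m \<in> Arr C \<Longrightarrow> sub_equiv C m m"
  by (simp add: sub_equiv_def factors_through_refl)

lemma in_sub_class: "m \<in> M \<Longrightarrow> m \<in> sub_class C M m"
  by (simp add: sub_class_def sub_equiv_refl M_in_Arr)

lemma sub_class_eqI:
  assumes "m \<in> Arr C" "n \<in> Arr C" "sub_equiv C m n"
  shows "sub_class C M m = sub_class C M n"
  using assms M_in_Arr factors_through_trans unfolding sub_class_def sub_equiv_def by blast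

text \<open>\<open>sub_le\<close> asks only for some pair of representatives; since representatives
  factor through each other, any pair will do. This carries inequalities between classes over to
  arrows.\<close>

lemma sub_le_class_iff:
  assumes "m \<in> M" "n \<in> M"
  shows "sub_le C (sub_class C M m) (sub_class C M n) \<longleftrightarrow> factors_through C m n"
proof
  assume "sub_le C (sub_class C M m) (sub_class C M n)"
  then obtain m' n' where "m' \<in> M" "n' \<in> M" "factors_through C m m'" "factors_through C m' n'"
      "factors_through C n' n"
    unfolding sub_le_def sub_class_def sub_equiv_def by blast
  then show "factors_through C m n"
    using assms M_in_Arr factors_through_trans by metis
next
  assume "factors_through C m n"
  then show "sub_le C (sub_class C M m) (sub_class C M n)"
    using assms in_sub_class unfolding sub_le_def by blast
qed

lemma sub_class_in_sub: "m \<in> M \<Longrightarrow> Cod C m = X \<Longrightarrow> sub_class C M m \<in> sub C M X"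
  unfolding sub_def by blast

lemma subE:
  assumes "K \<in> sub C M X"
  obtains m where "m \<in> M" "Cod C m = X" "K = sub_class C M m"
  using assms unfolding sub_def by blast

lemma sub_le_refl: "K \<in> sub C M X \<Longrightarrow> sub_le C K K"
  by (metis subE sub_le_class_iff factors_through_refl M_in_Arr)

lemma sub_le_trans:
  assumes "K \<in> sub C M X" "L \<in> sub C M X" "N \<in> sub C M X" "sub_le C K L" "sub_le C L N"
  shows "sub_le C K N"
proof -
  obtain k l n where "k \<in> M" "K = sub_class C M k" "l \<in> M" "L = sub_class C M l"
      "n \<in> M" "N = sub_class C M n"
    using assms(1-3) by (auto elim!: subE)
  then show ?thesis
    using assms(4,5) factors_through_trans M_in_Arr by (auto simp: sub_le_class_iff)
qed

lemma sub_le_antisym: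
  assumes "K \<in> sub C M X" "L \<in> sub C M X" "sub_le C K L" "sub_le C L K"
  shows "K = L"
proof -
  obtain k l where "k \<in> M" "K = sub_class C M k" "l \<in> M" "L = sub_class C M l"
    using assms(1,2) by (auto elim!: subE)
  then show ?thesis
    using assms(3,4) sub_class_eqI M_in_Arr by (auto simp: sub_le_class_iff sub_equiv_def)
qed

text \<open>The image of \<open>m\<close> is the least arrow of \<open>M\<close> through which
  \<open>f \<cdot> m\<close> factors. Leastness makes all factorizations of all representatives
  equivalent, so the union defining \<open>sub_image\<close> collapses to one class.\<close>

lemma sub_image_class:
  assumes f: "f \<in> Hom C X Y" and m: "m \<in> M" "Cod C m = X"
  obtains n where "n \<in> M" "Cod C n = Y" "sub_image C E M f (sub_class C M m) = sub_class C M n"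
    "factors_through C (f \<cdot> m) n"
    "\<And>k. k \<in> M \<Longrightarrow> factors_through C (f \<cdot> m) k \<Longrightarrow> factors_through C n k"
proof -
  have comp: "f \<cdot> k \<in> Hom C (Dom C k) Y" if "k \<in> M" "Cod C k = X" for k
    using Comp_Hom[OF _ f] that M_in_Arr by (auto simp: Hom_def)
  \<comment> \<open>Leastness comes from diagonalization: if
    \<open>n \<cdot> e = k \<cdot> j\<close>, the diagonal of this square exhibits \<open>n\<close>
    as factoring through \<open>k\<close>.\<close>
  have le: "factors_through C n k"
    if en: "e \<in> E" "n \<in> M" "Cod C e = Dom C n" and k: "k \<in> M" "factors_through C (n \<cdot> e) k"
    for n e k
  proof -
    have ne: "n \<cdot> e \<in> Hom C (Dom C e) (Cod C n)"
      using Comp_Hom[of e "Dom C e" "Dom C n" n] en E_Arr M_in_Arr by (auto simp: Hom_def)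
    obtain j where j: "Cod C (n \<cdot> e) = Cod C k" "j \<in> Hom C (Dom C (n \<cdot> e)) (Dom C k)"
        "k \<cdot> j = n \<cdot> e"
      using k(2) by (rule factors_throughE)
    have "\<exists>!d. d \<in> Hom C (Cod C e) (Dom C k) \<and> d \<cdot> e = j \<and> k \<cdot> d = n"
      using diagonalization[of e k j n] en k j ne M_in_Arr by (auto simp: Hom_def)
    then show ?thesis
      using j(1) ne en(3) unfolding factors_through_def by (auto simp: Hom_def)
  qed
  have fac: "factors_through C (n \<cdot> e) n" if "e \<in> E" "n \<in> M" "Cod C e = Dom C n" for n e
    using factors_through_Comp[of n e "Dom C e"] that E_Arr M_in_Arr by (auto simp: Hom_def)
  obtain e n where en: "e \<in> E" "n \<in> M" "Cod C e = Dom C n" "f \<cdot> m = n \<cdot> e"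
    using factorization[of "f \<cdot> m"] comp[OF m] by (auto simp: Hom_def)
  have cod: "Cod C n = Y"
    using fac[OF en(1-3)] en(4) comp[OF m] by (auto simp: Hom_def factors_through_def)
  \<comment> \<open>Equivalent representatives \<open>k\<close> and \<open>m\<close> give composites
    with \<open>f\<close> that factor through each other, so each of \<open>n\<close>,
    \<open>n'\<close> lies below the other by leastness.\<close>
  have eq: "sub_class C M n' = sub_class C M n"
    if k: "k \<in> sub_class C M m" and n': "n' \<in> M" and e': "e' \<in> E" "Cod C e' = Dom C n'"
      and fk: "f \<cdot> k = n' \<cdot> e'" for k n' e'
  proof -
    have kM: "k \<in> M" "factors_through C k m" "factors_through C m k"
      using k by (auto simp: sub_class_def sub_equiv_def)
    have codk: "Cod C k = X"
      using kM(2) m(2) by (auto simp: factors_through_def)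
    have "factors_through C (f \<cdot> k) (f \<cdot> m)" "factors_through C (f \<cdot> m) (f \<cdot> k)"
      using factors_through_Comp_left[OF kM(2)] factors_through_Comp_left[OF kM(3)]
        M_in_Arr kM(1) m codk f by auto
    then have "factors_through C (n' \<cdot> e') n" "factors_through C (n \<cdot> e) n'"
      using factors_through_trans fac[OF en(1-3)] fac[OF e'(1) n' e'(2)] en(2,4) n' fk M_in_Arr
      by metis+
    then have "sub_equiv C n' n"
      using le e' n' en(1-3) by (simp add: sub_equiv_def)
    then show ?thesis
      using sub_class_eqI M_in_Arr n' en(2) by blast
  qed
  have "sub_image C E M f (sub_class C M m) = sub_class C M n"
  proof
    show "sub_image C E M f (sub_class C M m) \<subseteq> sub_class C M n"
      unfolding sub_image_def using eq by blast
    show "sub_class C M n \<subseteq> sub_image C E M f (sub_class C M m)"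
      unfolding sub_image_def using en in_sub_class[OF m(1)] by blast
  qed
  then show thesis
    using that[of n] en cod fac[OF en(1-3)] le[OF en(1-3)] by simp
qed

end

section \<open>Preimages as pullbacks and infima as intersections\<close>

context complete_factorization_system
begin

text \<open>The final equivalence, tested on the pullbacks themselves, shows that any two choices of
  representative and pullback are equivalent; hence the union in \<open>sub_preimage\<close> is a
  single class. It is stated for all arrows \<open>g\<close> into \<open>X\<close>, not only for
  those in \<open>M\<close>.\<close>

lemma sub_preimage_class:
  assumes f: "f \<in> Hom C X Y" and n: "n \<in> M" "Cod C n = Y"
  obtains p where "p \<in> M" "Cod C p = X" "sub_preimage C M f (sub_class C M n) = sub_class C M p"
    "\<And>g. g \<in> Arr C \<Longrightarrow> Cod C g = X \<Longrightarrow>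
      factors_through C g p \<longleftrightarrow> factors_through C (f \<cdot> g) n"
proof -
  obtain p q where p: "p \<in> M" and pb: "is_pullback C f n p q"
    using M_pullback[of f n] f n by (auto simp: Hom_def)
  have cod: "Cod C p = X"
    using pb f by (auto simp: is_pullback_def Hom_def)
  have iff: "factors_through C g p \<longleftrightarrow> factors_through C (f \<cdot> g) n"
    if "g \<in> Arr C" "Cod C g = X" for g
    using pullback_factors_through_iff[OF pb] that f by (auto simp: Hom_def)
  have eq: "sub_class C M p' = sub_class C M p"
    if n': "n' \<in> sub_class C M n" and pb': "is_pullback C f n' p' q'" for n' p' q'
  proof -
    have nM: "n' \<in> M" "factors_through C n' n" "factors_through C n n'"
      using n' by (auto simp: sub_class_def sub_equiv_def)
    have p': "p' \<in> Arr C" "Cod C p' = X"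
      using pb' f by (auto simp: is_pullback_def Hom_def)
    have iff': "factors_through C g p' \<longleftrightarrow> factors_through C (f \<cdot> g) n'"
      if "g \<in> Arr C" "Cod C g = X" for g
      using pullback_factors_through_iff[OF pb'] that f by (auto simp: Hom_def)
    have "factors_through C p' p \<and> factors_through C p p'"
      using iff iff' p' p cod nM n(1) M_in_Arr factors_through_refl factors_through_trans by metis
    then show ?thesis
      using sub_class_eqI p' p M_in_Arr by (auto simp: sub_equiv_def)
  qed
  have "sub_preimage C M f (sub_class C M n) = sub_class C M p"
  proof
    show "sub_preimage C M f (sub_class C M n) \<subseteq> sub_class C M p"
      unfolding sub_preimage_def using eq by blast
    show "sub_class C M p \<subseteq> sub_preimage C M f (sub_class C M n)"
      unfolding sub_preimage_def using pb in_sub_class[OF n(1)] by blast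
  qed
  then show thesis
    using that p cod iff by blast
qed

lemma sub_preimage_in_sub:
  assumes "f \<in> Hom C X Y" "N \<in> sub C M Y"
  shows "sub_preimage C M f N \<in> sub C M X"
  using assms by (metis subE sub_preimage_class sub_class_in_sub)

text \<open>These facts justify the definite description in \<open>sub_Inf\<close>: an intersection
  of arrows represents a greatest lower bound, and antisymmetry makes its class unique. For empty
  \<open>S\<close> it is the top subobject of \<open>X\<close>.\<close>

lemma sub_Inf_props:
  assumes X: "X \<in> Obj C" and S: "S \<subseteq> sub C M X"
  shows "sub_Inf C M X S \<in> sub C M X"
    and "N \<in> S \<Longrightarrow> sub_le C (sub_Inf C M X S) N"
    and "L \<in> sub C M X \<Longrightarrow> (\<And>N. N \<in> S \<Longrightarrow> sub_le C L N) \<Longrightarrow> sub_le C L (sub_Inf C M X S)"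
proof -
  let ?P = "\<lambda>K. K \<in> sub C M X \<and> (\<forall>N \<in> S. sub_le C K N) \<and>
    (\<forall>L \<in> sub C M X. (\<forall>N \<in> S. sub_le C L N) \<longrightarrow> sub_le C L K)"
  \<comment> \<open>Intersections are formed of arrows, so the family \<open>S\<close> of classes is
    replaced by all representatives of its members.\<close>
  let ?T = "{n \<in> M. Cod C n = X \<and> sub_class C M n \<in> S}"
  obtain m where m: "m \<in> M" "is_intersection C X ?T m"
    using M_intersection[OF X, of ?T] by auto
  have cod: "Cod C m = X"
    using m(2) by (simp add: is_intersection_def)
  have low: "sub_le C (sub_class C M m) N" if N: "N \<in> S" for N
  proof -
    obtain n where n: "n \<in> M" "Cod C n = X" "N = sub_class C M n"
      using N S by (auto elim: subE)
    then have "factors_through C m n"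
      using m(2) N by (auto simp: is_intersection_def)
    then show ?thesis
      using n m(1) sub_le_class_iff by simp
  qed
  have great: "sub_le C L (sub_class C M m)"
    if L: "L \<in> sub C M X" and le: "\<forall>N \<in> S. sub_le C L N" for L
  proof -
    obtain l where l: "l \<in> M" "Cod C l = X" "L = sub_class C M l"
      using L by (rule subE)
    have "\<forall>n \<in> ?T. factors_through C l n"
      using le l sub_le_class_iff by auto
    then have "factors_through C l m"
      using m(2) l M_in_Arr by (auto simp: is_intersection_def)
    then show ?thesis
      using l m(1) sub_le_class_iff by simp
  qed
  have "?P (sub_class C M m)"
    using m(1) cod low great sub_class_in_sub by blast
  then have "\<exists>!K. ?P K"
    using sub_le_antisym by blast
  then have "?P (sub_Inf C M X S)"
    unfolding sub_Inf_def by (rule theI')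
  then show "sub_Inf C M X S \<in> sub C M X"
    and "N \<in> S \<Longrightarrow> sub_le C (sub_Inf C M X S) N"
    and "L \<in> sub C M X \<Longrightarrow> (\<And>N. N \<in> S \<Longrightarrow> sub_le C L N) \<Longrightarrow> sub_le C L (sub_Inf C M X S)"
    by blast+
qed

end


section \<open>The closure induced by an intersection-preserving topogenous order\<close>

locale Inf_topogenous_order = complete_factorization_system C E M + topogenous_order C M R
  for C :: "('o, 'a) cat" and E M :: "'a set" and R :: "'o \<Rightarrow> 'a set \<Rightarrow> 'a set \<Rightarrow> bool" +
  assumes Inf_preserving: "Inf_preserving C M R"
begin

abbreviation cl :: "'o \<Rightarrow> 'a set \<Rightarrow> 'a set"
  where "cl \<equiv> topogenous_closure C M R"

lemma cl_in_sub: "X \<in> Obj C \<Longrightarrow> cl X K \<in> sub C M X"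
  unfolding topogenous_closure_def by (rule sub_Inf_props) auto

text \<open>Preservation of infima, applied to the family of all \<open>p\<close> with
  \<open>R X K p\<close>, makes their infimum a member of that family. Together with
  \<open>cl_le\<close>, \<open>cl X K\<close> is thus the least such \<open>p\<close>.\<close>

lemma R_cl: "X \<in> Obj C \<Longrightarrow> K \<in> sub C M X \<Longrightarrow> R X K (cl X K)"
  using Inf_preserving unfolding Inf_preserving_def topogenous_closure_def by simp

lemma cl_le: "X \<in> Obj C \<Longrightarrow> R X K N \<Longrightarrow> sub_le C (cl X K) N"
  unfolding topogenous_closure_def by (rule sub_Inf_props) (auto dest: on_sub)

lemma le_cl: "X \<in> Obj C \<Longrightarrow> K \<in> sub C M X \<Longrightarrow> sub_le C K (cl X K)"
  by (rule T1[OF _ R_cl])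

text \<open>By (T2), \<open>K\<close> below \<open>L\<close> and \<open>R X L (cl X L)\<close> give
  \<open>R X K (cl X L)\<close>; now \<open>cl X K\<close> is least.\<close>

lemma cl_mono:
  assumes "X \<in> Obj C" "K \<in> sub C M X" "L \<in> sub C M X" "sub_le C K L"
  shows "sub_le C (cl X K) (cl X L)"
  using assms cl_le T2[OF assms(1,2) cl_in_sub[OF assms(1)] assms(4) R_cl[OF assms(1,3)]]
    sub_le_refl[OF cl_in_sub[OF assms(1)]] by blast

text \<open>An interpolant \<open>P\<close> between \<open>K\<close> and \<open>cl X K\<close> lies
  above \<open>cl X K\<close>, so (T2) yields \<open>R X (cl X K) (cl X K)\<close>.\<close>

lemma cl_cl_le:
  assumes "interpolative C M R" "X \<in> Obj C" "K \<in> sub C M X"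
  shows "sub_le C (cl X (cl X K)) (cl X K)"
proof -
  obtain P where P: "P \<in> sub C M X" "R X K P" "R X P (cl X K)"
    using assms R_cl cl_in_sub unfolding interpolative_def by blast
  have "R X (cl X K) (cl X K)"
    using T2[OF assms(2) cl_in_sub cl_in_sub cl_le P(3)] assms(2) P(2) sub_le_refl[OF cl_in_sub]
    by blast
  then show ?thesis
    using assms(2) cl_le by blast
qed

text \<open>Continuity of \<open>f\<close> expressed by preimages instead of images. (T3) pulls
  \<open>R Y N (cl Y N)\<close> back along \<open>f\<close>, (T2) lowers the left side to
  \<open>K\<close>, and \<open>cl X K\<close> is least.\<close>

lemma cl_le_preimage_cl:
  assumes f: "f \<in> Hom C X Y" and X: "X \<in> Obj C" and Y: "Y \<in> Obj C"
    and K: "K \<in> sub C M X" and N: "N \<in> sub C M Y"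
    and le: "sub_le C K (sub_preimage C M f N)"
  shows "sub_le C (cl X K) (sub_preimage C M f (cl Y N))"
proof -
  let ?Q = "sub_preimage C M f (cl Y N)"
  have Q: "?Q \<in> sub C M X"
    using sub_preimage_in_sub[OF f cl_in_sub[OF Y]] .
  have "R X (sub_preimage C M f N) ?Q"
    using T3[OF f R_cl[OF Y N]] .
  then have "R X K ?Q"
    using T2[OF X K Q le] sub_le_refl[OF Q] by blast
  then show ?thesis
    using cl_le X by blast
qed

end


section \<open>Transporting the closure along the adjunction\<close>

lemma (in cat_functor) amap_factors_through:
  assumes "factors_through A f m" "m \<in> Arr A"
  shows "factors_through C (amap F f) (amap F m)"
proof -
  obtain j where j: "Cod A f = Cod A m" "j \<in> Hom A (Dom A f) (Dom A m)" "m \<cdot>\<^bsub>A\<^esub> j = f"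
    using assms(1) by (rule A.factors_throughE)
  have "amap F f = amap F m \<cdot>\<^bsub>C\<^esub> amap F j"
    using amap_Comp[OF j(2) A.Arr_Hom[OF assms(2)]] j(3) by simp
  then show ?thesis
    using C.factors_through_Comp[of "amap F m" "amap F j"] amap_Hom[OF j(2)]
      amap_Hom[OF A.Arr_Hom[OF assms(2)]] by (auto simp: Hom_def)
qed

text \<open>A functor preserves factoring, hence sends equivalent arrows to equivalent arrows, and
  the union in \<open>fctr_sub\<close> is a single class.\<close>

lemma (in cat_functor) fctr_sub_class:
  assumes "factorization_system A E' M'" "factorization_system C E M"
    and "preserves_subobjects F M' M" and m: "m \<in> M'"
  shows "fctr_sub C M F (sub_class A M' m) = sub_class C M (amap F m)"
proof -
  interpret A': factorization_system A E' M' by fact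
  interpret C': factorization_system C E M by fact
  have "sub_class C M (amap F k) = sub_class C M (amap F m)" if "k \<in> sub_class A M' m" for k
  proof (rule C'.sub_class_eqI)
    have k: "k \<in> M'" "factors_through A k m" "factors_through A m k"
      using that by (auto simp: sub_class_def sub_equiv_def)
    show "amap F k \<in> Arr C" "amap F m \<in> Arr C"
      using k(1) m assms(3) C'.M_in_Arr by (auto simp: preserves_subobjects_def)
    show "sub_equiv C (amap F k) (amap F m)"
      using k m amap_factors_through A'.M_in_Arr by (simp add: sub_equiv_def)
  qed
  then show ?thesis
    using A'.in_sub_class[OF m] unfolding fctr_sub_def by blast
qed

text \<open>Transposition matches arrows \<open>h\<close> from \<open>F W\<close> to
  \<open>N\<close> with arrows from \<open>W\<close> to \<open>G N\<close>. Under it,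
  \<open>n h = F g\<close> corresponds to the factorization of \<open>\<eta> X\<close> after
  \<open>g\<close> through \<open>G n\<close>, because the latter composite is the transpose of
  \<open>F g\<close> by naturality (\<open>nat\<close>).\<close>

lemma (in adjunction_with_unit) unit_factors_through_iff:
  assumes g: "g \<in> Hom A W X" and n: "n \<in> Hom C N (omap F X)"
  shows "factors_through A (\<eta> X \<cdot>\<^bsub>A\<^esub> g) (amap G n) \<longleftrightarrow> factors_through C (amap F g) n"
proof
  have W: "W \<in> Obj A" and X: "X \<in> Obj A" and N: "N \<in> Obj C"
    using g n F.A.Dom_Obj F.A.Cod_Obj F.C.Dom_Obj by (auto simp: Hom_def)
  have Fg: "amap F g \<in> Hom C (omap F W) (omap F X)"
    using F.amap_Hom[OF g] .
  have Gn: "amap G n \<in> Hom A (omap G N) (omap G (omap F X))"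
    using G.amap_Hom[OF n] .
  have eg: "\<eta> X \<cdot>\<^bsub>A\<^esub> g \<in> Hom A W (omap G (omap F X))"
    using F.A.Comp_Hom[OF g unit_Hom[OF X]] .
  have nat: "amap G (amap F g) \<cdot>\<^bsub>A\<^esub> \<eta> W = \<eta> X \<cdot>\<^bsub>A\<^esub> g"
    using unit_natural[OF g] .
  have transpose: "amap G n \<cdot>\<^bsub>A\<^esub> (amap G h \<cdot>\<^bsub>A\<^esub> \<eta> W) = amap G (n \<cdot>\<^bsub>C\<^esub> h) \<cdot>\<^bsub>A\<^esub> \<eta> W"
    if "h \<in> Hom C (omap F W) N" for h
    using F.A.Comp_assoc[OF unit_Hom[OF W] G.amap_Hom[OF that] Gn] G.amap_Comp[OF that n] by simp
  {
    assume "factors_through A (\<eta> X \<cdot>\<^bsub>A\<^esub> g) (amap G n)"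
    then obtain h' where h': "h' \<in> Hom A W (omap G N)" "amap G n \<cdot>\<^bsub>A\<^esub> h' = \<eta> X \<cdot>\<^bsub>A\<^esub> g"
      using eg Gn by (auto simp: Hom_def elim: F.A.factors_throughE)
    obtain h where h: "h \<in> Hom C (omap F W) N" "amap G h \<cdot>\<^bsub>A\<^esub> \<eta> W = h'"
      using unit_universal[OF W N h'(1)] by blast
    have "amap G (n \<cdot>\<^bsub>C\<^esub> h) \<cdot>\<^bsub>A\<^esub> \<eta> W = \<eta> X \<cdot>\<^bsub>A\<^esub> g"
      using transpose[OF h(1)] h(2) h'(2) by simp
    \<comment> \<open>Both sides have the same transpose, so the uniqueness half of the universal
      property of \<open>\<eta> W\<close> applies.\<close>
    then have "n \<cdot>\<^bsub>C\<^esub> h = amap F g"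
      using unit_universal[OF W F.omap_Obj[OF X] eg] F.C.Comp_Hom[OF h(1) n] Fg nat by blast
    then show "factors_through C (amap F g) n"
      using F.C.factors_through_Comp[of n h] h(1) n by (auto simp: Hom_def)
  next
    assume "factors_through C (amap F g) n"
    then obtain h where h: "h \<in> Hom C (omap F W) N" "n \<cdot>\<^bsub>C\<^esub> h = amap F g"
      using Fg n by (auto simp: Hom_def elim: F.C.factors_throughE)
    have "amap G n \<cdot>\<^bsub>A\<^esub> (amap G h \<cdot>\<^bsub>A\<^esub> \<eta> W) = \<eta> X \<cdot>\<^bsub>A\<^esub> g"
      using transpose[OF h(1)] h(2) nat by simp
    then show "factors_through A (\<eta> X \<cdot>\<^bsub>A\<^esub> g) (amap G n)"
      using F.A.factors_through_Comp[of "amap G n" "amap G h \<cdot>\<^bsub>A\<^esub> \<eta> W"] Gn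
        F.A.Comp_Hom[OF unit_Hom[OF W] G.amap_Hom[OF h(1)]] by (auto simp: Hom_def)
  }
qed

section \<open>The closure pulled back along the unit\<close>

locale adjoint_topogenous_order =
  adjunction_with_unit A C F G \<eta> + A: complete_factorization_system A E' M' +
  C: Inf_topogenous_order C E M R
  for A :: "('p, 'b) cat" and E' M' :: "'b set" and C :: "('o, 'a) cat" and E M :: "'a set"
    and F :: "('p, 'b, 'o, 'a) fctr" and G :: "('o, 'a, 'p, 'b) fctr" and \<eta> :: "'p \<Rightarrow> 'b"
    and R :: "'o \<Rightarrow> 'a set \<Rightarrow> 'a set \<Rightarrow> bool" +
  assumes F_M: "preserves_subobjects F M' M"
    and G_M: "preserves_subobjects G M M'"
begin

abbreviation ucl :: "'p \<Rightarrow> 'b set \<Rightarrow> 'b set"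
  where "ucl \<equiv> unit_closure A M' C M F G \<eta> R"

lemma F_sub_class: "m \<in> M' \<Longrightarrow> fctr_sub C M F (sub_class A M' m) = sub_class C M (amap F m)"
  by (rule F.fctr_sub_class[OF A.factorization_system_axioms C.factorization_system_axioms F_M])

lemma amap_F_M:
  assumes "m \<in> M'" "Cod A m = X"
  shows "amap F m \<in> M" "Cod C (amap F m) = omap F X"
  using assms F_M F.amap_Hom[OF F.A.Arr_Hom[OF A.M_in_Arr[OF assms(1)]]]
  by (auto simp: preserves_subobjects_def Hom_def)

lemma F_in_sub: "K \<in> sub A M' X \<Longrightarrow> fctr_sub C M F K \<in> sub C M (omap F X)"
  by (metis A.subE F_sub_class amap_F_M C.sub_class_in_sub)

lemma F_sub_mono:
  assumes "K \<in> sub A M' X" "L \<in> sub A M' X" "sub_le A K L"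
  shows "sub_le C (fctr_sub C M F K) (fctr_sub C M F L)"
proof -
  obtain k l where "k \<in> M'" "K = sub_class A M' k" "l \<in> M'" "L = sub_class A M' l"
    using assms(1,2) by (auto elim!: A.subE)
  then show ?thesis
    using assms(3) F.amap_factors_through A.M_in_Arr amap_F_M(1)
    by (simp add: F_sub_class A.sub_le_class_iff C.sub_le_class_iff)
qed

text \<open>Combines the universal property of the pullback along \<open>\<eta> X\<close> with
  transposition. The equivalence covers arbitrary arrows \<open>g\<close> into \<open>X\<close>,
  since (C3) applies it to a composite that need not lie in \<open>M'\<close>.\<close>

lemma ucl_class:
  assumes X: "X \<in> Obj A" and K: "K \<in> sub A M' X"
  obtains d k where "d \<in> M'" "Cod A d = X" "ucl X K = sub_class A M' d"
    "k \<in> M" "Cod C k = omap F X" "C.cl (omap F X) (fctr_sub C M F K) = sub_class C M k"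
    "\<And>g. g \<in> Arr A \<Longrightarrow> Cod A g = X \<Longrightarrow>
      factors_through A g d \<longleftrightarrow> factors_through C (amap F g) k"
proof -
  obtain k where k: "k \<in> M" "Cod C k = omap F X"
      "C.cl (omap F X) (fctr_sub C M F K) = sub_class C M k"
    using C.cl_in_sub[OF F.omap_Obj[OF X]] by (rule C.subE)
  have kH: "k \<in> Hom C (Dom C k) (omap F X)"
    using k C.M_in_Arr by (simp add: Hom_def)
  have Gk: "amap G k \<in> M'" "Cod A (amap G k) = omap G (omap F X)"
    using G_M k(1) G.amap_Hom[OF kH] by (auto simp: preserves_subobjects_def Hom_def)
  obtain d where d: "d \<in> M'" "Cod A d = X"
    "sub_preimage A M' (\<eta> X) (sub_class A M' (amap G k)) = sub_class A M' d"
    "\<And>g. g \<in> Arr A \<Longrightarrow> Cod A g = X \<Longrightarrow>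
      factors_through A g d \<longleftrightarrow> factors_through A (\<eta> X \<cdot>\<^bsub>A\<^esub> g) (amap G k)"
    using A.sub_preimage_class[OF unit_Hom[OF X] Gk] by metis
  have eq: "ucl X K = sub_class A M' d"
    unfolding unit_closure_def k(3) d(3)[symmetric]
    by (simp add: G.fctr_sub_class[OF C.factorization_system_axioms A.factorization_system_axioms
          G_M k(1)])
  have "factors_through A g d \<longleftrightarrow> factors_through C (amap F g) k"
    if "g \<in> Arr A" "Cod A g = X" for g
    using d(4)[OF that] unit_factors_through_iff[OF _ kH, of g "Dom A g"] that
    by (simp add: Hom_def)
  then show thesis
    using that d(1,2) eq k by blast
qed

lemma ucl_in_sub: "X \<in> Obj A \<Longrightarrow> K \<in> sub A M' X \<Longrightarrow> ucl X K \<in> sub A M' X"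
  by (metis ucl_class A.sub_class_in_sub)

text \<open>The equivalence of \<open>ucl_class\<close>, restricted to representatives of subobjects
  and restated for classes.\<close>

lemma le_ucl_iff:
  assumes X: "X \<in> Obj A" and K: "K \<in> sub A M' X" and L: "L \<in> sub A M' X"
  shows "sub_le A L (ucl X K) \<longleftrightarrow>
    sub_le C (fctr_sub C M F L) (C.cl (omap F X) (fctr_sub C M F K))"
proof -
  obtain d k where d: "d \<in> M'" "ucl X K = sub_class A M' d"
    and k: "k \<in> M" "C.cl (omap F X) (fctr_sub C M F K) = sub_class C M k"
    and iff: "\<And>g. g \<in> Arr A \<Longrightarrow> Cod A g = X \<Longrightarrow>
      factors_through A g d \<longleftrightarrow> factors_through C (amap F g) k"
    using ucl_class[OF X K] by metis
  obtain l where l: "l \<in> M'" "Cod A l = X" "L = sub_class A M' l"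
    using L by (rule A.subE)
  show ?thesis
    unfolding d(2) k(2) l(3) F_sub_class[OF l(1)] A.sub_le_class_iff[OF l(1) d(1)]
      C.sub_le_class_iff[OF amap_F_M(1)[OF l(1,2)] k(1)]
    using iff l A.M_in_Arr by blast
qed

text \<open>Continuity of \<open>F\<close>: the case \<open>L = ucl X K\<close> of
  \<open>le_ucl_iff\<close>.\<close>

lemma F_ucl_le:
  assumes "X \<in> Obj A" "K \<in> sub A M' X"
  shows "sub_le C (fctr_sub C M F (ucl X K)) (C.cl (omap F X) (fctr_sub C M F K))"
  using le_ucl_iff[OF assms ucl_in_sub[OF assms]] A.sub_le_refl[OF ucl_in_sub[OF assms]] by blast

text \<open>(C3) is proved on representatives: \<open>n\<close> for the image of \<open>K\<close>,
  \<open>d\<close> and \<open>d'\<close> for the closures of \<open>K\<close> and of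
  \<open>n\<close>, and \<open>i\<close> for the image of \<open>d\<close>. As \<open>i\<close> is
  least, it suffices that \<open>f\<close> after \<open>d\<close> factors through \<open>d'\<close>,
  which is checked in \<open>C\<close> after transposing.\<close>

lemma image_ucl_le:
  assumes f: "f \<in> Hom A X Y" and K: "K \<in> sub A M' X"
  shows "sub_le A (sub_image A E' M' f (ucl X K)) (ucl Y (sub_image A E' M' f K))"
proof -
  have X: "X \<in> Obj A" and Y: "Y \<in> Obj A"
    using f F.A.Dom_Obj F.A.Cod_Obj by (auto simp: Hom_def)
  have Ff: "amap F f \<in> Hom C (omap F X) (omap F Y)"
    using F.amap_Hom[OF f] .
  obtain m where m: "m \<in> M'" "Cod A m = X" "K = sub_class A M' m"
    using K by (rule A.subE)
  obtain n where n: "n \<in> M'" "Cod A n = Y" "sub_image A E' M' f K = sub_class A M' n"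
      "factors_through A (f \<cdot>\<^bsub>A\<^esub> m) n"
    using A.sub_image_class[OF f m(1,2)] m(3) by metis
  have N: "sub_class A M' n \<in> sub A M' Y"
    using n A.sub_class_in_sub by blast
  obtain d k where d: "d \<in> M'" "Cod A d = X" "ucl X K = sub_class A M' d"
    and k: "k \<in> M" "Cod C k = omap F X"
      "C.cl (omap F X) (fctr_sub C M F K) = sub_class C M k"
    and d_iff: "\<And>g. g \<in> Arr A \<Longrightarrow> Cod A g = X \<Longrightarrow>
      factors_through A g d \<longleftrightarrow> factors_through C (amap F g) k"
    using ucl_class[OF X K] by metis
  obtain d' k' where d': "d' \<in> M'" "Cod A d' = Y" "ucl Y (sub_class A M' n) = sub_class A M' d'"
    and k': "k' \<in> M" "Cod C k' = omap F Y"
      "C.cl (omap F Y) (fctr_sub C M F (sub_class A M' n)) = sub_class C M k'"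
    and d'_iff: "\<And>g. g \<in> Arr A \<Longrightarrow> Cod A g = Y \<Longrightarrow>
      factors_through A g d' \<longleftrightarrow> factors_through C (amap F g) k'"
    using ucl_class[OF Y N] by metis
  obtain i where i: "i \<in> M'" "Cod A i = Y" "sub_image A E' M' f (ucl X K) = sub_class A M' i"
      "\<And>l. l \<in> M' \<Longrightarrow> factors_through A (f \<cdot>\<^bsub>A\<^esub> d) l \<Longrightarrow> factors_through A i l"
    using A.sub_image_class[OF f d(1,2)] d(3) by metis
  have arr: "l \<in> Hom A (Dom A l) X" if "l \<in> M'" "Cod A l = X" for l
    using that A.M_in_Arr by (simp add: Hom_def)
  note Fm = amap_F_M[OF m(1,2)] and Fn = amap_F_M[OF n(1,2)] and Fd = amap_F_M[OF d(1,2)]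

  \<comment> \<open>Applying \<open>F\<close> to the factorization of \<open>f\<close> after
    \<open>m\<close> through \<open>n\<close> puts \<open>F m\<close> below the preimage of
    \<open>F n\<close> along \<open>F f\<close>, the hypothesis of
    \<open>cl_le_preimage_cl\<close>.\<close>
  have "factors_through C (amap F f \<cdot>\<^bsub>C\<^esub> amap F m) (amap F n)"
    using F.amap_factors_through[OF n(4) A.M_in_Arr[OF n(1)]] F.amap_Comp[OF arr[OF m(1,2)] f]
    by simp
  then have "sub_le C (sub_class C M (amap F m))
      (sub_preimage C M (amap F f) (sub_class C M (amap F n)))"
    using C.sub_preimage_class[OF Ff Fn] Fm C.M_in_Arr C.sub_le_class_iff by metis
  then have "sub_le C (sub_class C M k) (sub_preimage C M (amap F f) (sub_class C M k'))"
    using C.cl_le_preimage_cl[OF Ff F.omap_Obj[OF X] F.omap_Obj[OF Y]] Fm Fn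
      C.sub_class_in_sub k(3) k'(3) m(3) F_sub_class[OF m(1)] F_sub_class[OF n(1)] by metis
  moreover obtain p where p: "p \<in> M" "Cod C p = omap F X"
      "sub_preimage C M (amap F f) (sub_class C M k') = sub_class C M p"
      "\<And>g. g \<in> Arr C \<Longrightarrow> Cod C g = omap F X \<Longrightarrow>
        factors_through C g p \<longleftrightarrow> factors_through C (amap F f \<cdot>\<^bsub>C\<^esub> g) k'"
    using C.sub_preimage_class[OF Ff k'(1,2)] by metis
  ultimately have "factors_through C k p"
    using C.sub_le_class_iff k(1) by simp
  \<comment> \<open>The equivalence for \<open>d\<close>, tested on \<open>d\<close> itself.\<close>
  moreover have "factors_through C (amap F d) k"
    using d_iff[of d] d A.M_in_Arr F.A.factors_through_refl by blast
  ultimately have "factors_through C (amap F d) p"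
    using F.C.factors_through_trans C.M_in_Arr p(1) by blast
  then have "factors_through C (amap F (f \<cdot>\<^bsub>A\<^esub> d)) k'"
    using p(4) Fd C.M_in_Arr F.amap_Comp[OF arr[OF d(1,2)] f] by simp
  \<comment> \<open>Transposing back to \<open>A\<close> by the equivalence for
    \<open>d'\<close>.\<close>
  then have "factors_through A (f \<cdot>\<^bsub>A\<^esub> d) d'"
    using d'_iff F.A.Comp_Hom[OF arr[OF d(1,2)] f] by (simp add: Hom_def)
  then have "factors_through A i d'"
    using i(4) d'(1) by blast
  then show ?thesis
    using A.sub_le_class_iff i(1,3) d'(1,3) n(3) by simp
qed

lemma closure_operator_ucl: "closure_operator A E' M' ucl"
proof
  fix X m n
  assume X: "X \<in> Obj A" and m: "m \<in> sub A M' X"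
  show "ucl X m \<in> sub A M' X"
    using ucl_in_sub[OF X m] .
  show "sub_le A m (ucl X m)"
    using le_ucl_iff[OF X m m] C.le_cl[OF F.omap_Obj[OF X] F_in_sub[OF m]] by blast
  assume n: "n \<in> sub A M' X" and "sub_le A m n"
  then have "sub_le C (C.cl (omap F X) (fctr_sub C M F m)) (C.cl (omap F X) (fctr_sub C M F n))"
    using C.cl_mono[OF F.omap_Obj[OF X]] F_in_sub F_sub_mono m by blast
  \<comment> \<open>By \<open>le_ucl_iff\<close> the claim is that \<open>F (ucl X m)\<close> lies
    below the closure of \<open>F n\<close>; the closure of \<open>F m\<close> lies between
    them.\<close>
  then show "sub_le A (ucl X m) (ucl X n)"
    using le_ucl_iff[OF X n ucl_in_sub[OF X m]] F_ucl_le[OF X m]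
      C.sub_le_trans F_in_sub[OF ucl_in_sub[OF X m]] C.cl_in_sub[OF F.omap_Obj[OF X]] by blast
qed (rule image_ucl_le)

text \<open>Writing \<open>c\<close> for the closure on \<open>C\<close>, the chain is
  \<open>F (ucl (ucl K))\<close> below \<open>c (F (ucl K))\<close> below \<open>c (c (F K))\<close>
  below \<open>c (F K)\<close>: continuity, continuity under the monotone \<open>c\<close>, and
  interpolation. Then \<open>le_ucl_iff\<close> returns to \<open>A\<close>.\<close>

lemma ucl_idempotent:
  assumes "interpolative C M R" and X: "X \<in> Obj A" and K: "K \<in> sub A M' X"
  shows "ucl X (ucl X K) = ucl X K"
proof -
  let ?c = "C.cl (omap F X)" and ?F = "fctr_sub C M F"
  note FX = F.omap_Obj[OF X]
  note cK = ucl_in_sub[OF X K] and ccK = ucl_in_sub[OF X ucl_in_sub[OF X K]]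
  note sub = C.cl_in_sub[OF FX] F_in_sub[OF cK] F_in_sub[OF ccK]
  have "sub_le C (?c (?F (ucl X K))) (?c (?c (?F K)))"
    using C.cl_mono[OF FX] F_ucl_le[OF X K] sub by blast
  then have "sub_le C (?c (?F (ucl X K))) (?c (?F K))"
    using C.cl_cl_le[OF assms(1) FX F_in_sub[OF K]] C.sub_le_trans sub by blast
  then have "sub_le C (?F (ucl X (ucl X K))) (?c (?F K))"
    using F_ucl_le[OF X cK] C.sub_le_trans sub by blast
  then have "sub_le A (ucl X (ucl X K)) (ucl X K)"
    using le_ucl_iff[OF X K ccK] by blast
  moreover have "sub_le A (ucl X K) (ucl X (ucl X K))"
    using closure_operator.C1[OF closure_operator_ucl X cK] .
  ultimately show ?thesis
    using A.sub_le_antisym ccK cK by blast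
qed

text \<open>Continuity of \<open>F\<close> for \<open>c'\<close> is literally the right side of
  \<open>le_ucl_iff\<close> at \<open>L = c' X K\<close>.\<close>

lemma ucl_largest:
  assumes "closure_operator A E' M' c'" "continuous_fctr A M' C M F c' C.cl"
  shows "closure_le A M' c' ucl"
  using assms le_ucl_iff closure_operator.closed_sub[OF assms(1)]
  unfolding closure_le_def continuous_fctr_def by blast

end

theorem proposition14:
  fixes C :: "('o, 'a) cat" and E M :: "'a set"
    and A :: "('p, 'b) cat" and E' M' :: "'b set"
    and F :: "('p, 'b, 'o, 'a) fctr" and G :: "('o, 'a, 'p, 'b) fctr"
    and \<eta> :: "'p \<Rightarrow> 'b"
    and R :: "'o \<Rightarrow> 'a set \<Rightarrow> 'a set \<Rightarrow> bool"
  assumes "proper_complete_factorization_system C E M"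
    and "complete_factorization_system A E' M'"
    and "adjunction_with_unit A C F G \<eta>"
    and "preserves_subobjects F M' M"
    and "preserves_subobjects G M M'"
    and "topogenous_order C M R"
    and "Inf_preserving C M R"
    and "interpolative C M R"
  shows "closure_operator A E' M' (unit_closure A M' C M F G \<eta> R) \<and>
    idempotent_on_sub A M' (unit_closure A M' C M F G \<eta> R) \<and>
    continuous_fctr A M' C M F (unit_closure A M' C M F G \<eta> R) (topogenous_closure C M R) \<and>
    (\<forall>c'. closure_operator A E' M' c' \<and>
        continuous_fctr A M' C M F c' (topogenous_closure C M R) \<longrightarrow>
      closure_le A M' c' (unit_closure A M' C M F G \<eta> R))"
proof -
  interpret C: proper_complete_factorization_system C E M by fact
  interpret adjoint_topogenous_order A E' M' C E M F G \<eta> R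
    by (intro adjoint_topogenous_order.intro adjoint_topogenous_order_axioms.intro
        Inf_topogenous_order.intro Inf_topogenous_order_axioms.intro
        C.complete_factorization_system_axioms assms)
  show ?thesis
    using closure_operator_ucl ucl_idempotent[OF assms(8)] F_ucl_le ucl_largest
    unfolding idempotent_on_sub_def continuous_fctr_def by blast
qed

end
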